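(* Let $n>1$ be an integer with prime power decomposition $n=2^t p_1^{\alpha_1}\cdots p_k^{\alpha_k}$, where $t\ge 0$, $k\geq 0$, $p_1,\dots,p_k$ are distinct odd primes and $\alpha_1,\dots,\alpha_k\ge 1$. Then the number of vertices of the graph $\Gamma(\mathbb{Z}_n[i,j,k])$ (equivalently, of $\overline{\Gamma}(\mathbb{Z}_n[i,j,k])$) is $$|V(\Gamma(\mathbb{Z}_n[i,j,k]))|=\begin{cases} n^4-\prod\limits_{i=1}^k\left(p_i^{4\alpha_i}-p_i^{4\alpha_i-1}-p_i^{4\alpha_i-2}+p_i^{4\alpha_i-3}\right)-1, & \text{if } t=0;\\ n^4-2^{4t-1}\prod\limits_{i=1}^k\left(p_i^{4\alpha_i}-p_i^{4\alpha_i-1}-p_i^{4\alpha_i-2}+p_i^{4\alpha_i-3}\right)-1, & \text{if } t>0.\end{cases}$$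
   Context: $\mathbb{Z}_n$ denotes the ring of integers modulo $n$. $\mathbb{Z}_n[i,j,k]=\{a+bi+cj+dk: a,b,c,d\in\mathbb{Z}_n\}$ is the ring of Lipschitz quaternions modulo $n$, with $i^2=j^2=k^2=ijk=-1$ and coefficients in $\mathbb{Z}_n$ central; it has $n^4$ elements. For a ring $R$, an element $x$ is a zero divisor if there is a nonzero $y\in R$ with $xy=0$ or $yx=0$; $Z(R)^*$ denotes the set of nonzero zero divisors. The directed zero divisor graph $\Gamma(R)$ has vertex set $Z(R)^*$ and a directed edge $x\to y$ for distinct $x,y$ iff $xy=0$. The undirected zero divisor graph $\overline{\Gamma}(R)$ has the same vertex set, with distinct $x,y$ adjacent iff $xy=0$ or $yx=0$. An empty product equals $1$. *)

theory Defs
  imports "HOL-Number_Theory.Residues" "Graph_Theory.Pair_Digraph"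
begin

text \<open>The quaternion \<open>a + b i + c j + d k\<close> is represented by \<open>Quat a b c d\<close>.\<close>

datatype 'a quaternion = Quat (qre: 'a) (qi: 'a) (qj: 'a) (qk: 'a)

text \<open>
  The product is the bilinear extension, with central coefficients, of
  \<open>i\<^sup>2 = j\<^sup>2 = k\<^sup>2 = ijk = -1\<close>.
\<close>

definition quaternion_ring :: "('a, 'm) ring_scheme \<Rightarrow> 'a quaternion ring" where
  "quaternion_ring R =
    \<lparr>carrier = {x. qre x \<in> carrier R \<and> qi x \<in> carrier R \<and> qj x \<in> carrier R \<and> qk x \<in> carrier R},
     monoid.mult = (\<lambda>x y. Quat
       (qre x \<otimes>\<^bsub>R\<^esub> qre y \<ominus>\<^bsub>R\<^esub> qi x \<otimes>\<^bsub>R\<^esub> qi y \<ominus>\<^bsub>R\<^esub> qj x \<otimes>\<^bsub>R\<^esub> qj y \<ominus>\<^bsub>R\<^esub> qk x \<otimes>\<^bsub>R\<^esub> qk y)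
       (qre x \<otimes>\<^bsub>R\<^esub> qi y \<oplus>\<^bsub>R\<^esub> qi x \<otimes>\<^bsub>R\<^esub> qre y \<oplus>\<^bsub>R\<^esub> qj x \<otimes>\<^bsub>R\<^esub> qk y \<ominus>\<^bsub>R\<^esub> qk x \<otimes>\<^bsub>R\<^esub> qj y)
       (qre x \<otimes>\<^bsub>R\<^esub> qj y \<ominus>\<^bsub>R\<^esub> qi x \<otimes>\<^bsub>R\<^esub> qk y \<oplus>\<^bsub>R\<^esub> qj x \<otimes>\<^bsub>R\<^esub> qre y \<oplus>\<^bsub>R\<^esub> qk x \<otimes>\<^bsub>R\<^esub> qi y)
       (qre x \<otimes>\<^bsub>R\<^esub> qk y \<oplus>\<^bsub>R\<^esub> qi x \<otimes>\<^bsub>R\<^esub> qj y \<ominus>\<^bsub>R\<^esub> qj x \<otimes>\<^bsub>R\<^esub> qi y \<oplus>\<^bsub>R\<^esub> qk x \<otimes>\<^bsub>R\<^esub> qre y)),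
     one = Quat \<one>\<^bsub>R\<^esub> \<zero>\<^bsub>R\<^esub> \<zero>\<^bsub>R\<^esub> \<zero>\<^bsub>R\<^esub>,
     zero = Quat \<zero>\<^bsub>R\<^esub> \<zero>\<^bsub>R\<^esub> \<zero>\<^bsub>R\<^esub> \<zero>\<^bsub>R\<^esub>,
     add = (\<lambda>x y. Quat (qre x \<oplus>\<^bsub>R\<^esub> qre y) (qi x \<oplus>\<^bsub>R\<^esub> qi y) (qj x \<oplus>\<^bsub>R\<^esub> qj y) (qk x \<oplus>\<^bsub>R\<^esub> qk y))\<rparr>"

definition lipschitz_mod :: "nat \<Rightarrow> int quaternion ring" where
  "lipschitz_mod n = quaternion_ring (residue_ring (int n))"

definition zero_divisors :: "('a, 'm) ring_scheme \<Rightarrow> 'a set" where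
  "zero_divisors R = {x \<in> carrier R. \<exists>y \<in> carrier R.
     y \<noteq> \<zero>\<^bsub>R\<^esub> \<and> (x \<otimes>\<^bsub>R\<^esub> y = \<zero>\<^bsub>R\<^esub> \<or> y \<otimes>\<^bsub>R\<^esub> x = \<zero>\<^bsub>R\<^esub>)}"

definition zero_divisor_digraph :: "('a, 'm) ring_scheme \<Rightarrow> 'a pair_pre_digraph" where
  "zero_divisor_digraph R =
    \<lparr>pverts = zero_divisors R - {\<zero>\<^bsub>R\<^esub>},
     parcs = {(x, y). x \<in> zero_divisors R - {\<zero>\<^bsub>R\<^esub>} \<and> y \<in> zero_divisors R - {\<zero>\<^bsub>R\<^esub>} \<and>
       x \<noteq> y \<and> x \<otimes>\<^bsub>R\<^esub> y = \<zero>\<^bsub>R\<^esub>}\<rparr>"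

text \<open>The undirected graph is encoded as a symmetric digraph.\<close>

definition zero_divisor_graph :: "('a, 'm) ring_scheme \<Rightarrow> 'a pair_pre_digraph" where
  "zero_divisor_graph R =
    \<lparr>pverts = zero_divisors R - {\<zero>\<^bsub>R\<^esub>},
     parcs = {(x, y). x \<in> zero_divisors R - {\<zero>\<^bsub>R\<^esub>} \<and> y \<in> zero_divisors R - {\<zero>\<^bsub>R\<^esub>} \<and>
       x \<noteq> y \<and> (x \<otimes>\<^bsub>R\<^esub> y = \<zero>\<^bsub>R\<^esub> \<or> y \<otimes>\<^bsub>R\<^esub> x = \<zero>\<^bsub>R\<^esub>)}\<rparr>"

lemma ring_quaternion_ring:
  assumes "cring R"
  shows "ring (quaternion_ring R)"
proof -
  interpret R: cring R by fact
  show ?thesis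
  proof (rule ringI)
    show "abelian_group (quaternion_ring R)"
    proof (rule abelian_groupI)
      fix x assume "x \<in> carrier (quaternion_ring R)"
      then show "\<exists>y\<in>carrier (quaternion_ring R).
          y \<oplus>\<^bsub>quaternion_ring R\<^esub> x = \<zero>\<^bsub>quaternion_ring R\<^esub>"
        by (intro bexI[of _ "Quat (\<ominus>\<^bsub>R\<^esub> qre x) (\<ominus>\<^bsub>R\<^esub> qi x) (\<ominus>\<^bsub>R\<^esub> qj x) (\<ominus>\<^bsub>R\<^esub> qk x)"])
           (auto simp: quaternion_ring_def R.l_neg)
    qed (auto simp: quaternion_ring_def R.a_ac quaternion.expand)
    show "monoid (quaternion_ring R)"
      by (rule monoidI)
         (auto simp: quaternion_ring_def quaternion.expand R.minus_eq R.minus_add R.l_distr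
           R.r_distr R.l_minus R.r_minus R.a_ac R.m_ac)
  qed (auto simp: quaternion_ring_def R.minus_eq R.minus_add R.l_distr R.r_distr R.l_minus
         R.r_minus R.a_ac R.m_ac)
qed

lemma quaternion_ring_relations:
  fixes R (structure)
  assumes "cring R"
  defines "Q \<equiv> quaternion_ring R"
  defines "i \<equiv> Quat \<zero> \<one> \<zero> \<zero>" and "j \<equiv> Quat \<zero> \<zero> \<one> \<zero>" and "k \<equiv> Quat \<zero> \<zero> \<zero> \<one>"
  shows "i \<otimes>\<^bsub>Q\<^esub> i = \<ominus>\<^bsub>Q\<^esub> \<one>\<^bsub>Q\<^esub>" "j \<otimes>\<^bsub>Q\<^esub> j = \<ominus>\<^bsub>Q\<^esub> \<one>\<^bsub>Q\<^esub>" "k \<otimes>\<^bsub>Q\<^esub> k = \<ominus>\<^bsub>Q\<^esub> \<one>\<^bsub>Q\<^esub>"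
    "i \<otimes>\<^bsub>Q\<^esub> j \<otimes>\<^bsub>Q\<^esub> k = \<ominus>\<^bsub>Q\<^esub> \<one>\<^bsub>Q\<^esub>"
proof -
  interpret R: cring R by fact
  interpret Q: ring Q unfolding Q_def by (rule ring_quaternion_ring) fact
  have "Quat (\<ominus> \<one>) \<zero> \<zero> \<zero> = \<ominus>\<^bsub>Q\<^esub> \<one>\<^bsub>Q\<^esub>"
    by (rule Q.minus_equality[symmetric]) (auto simp: Q_def quaternion_ring_def R.l_neg)
  then have m: "\<ominus>\<^bsub>Q\<^esub> \<one>\<^bsub>Q\<^esub> = Quat (\<ominus> \<one>) \<zero> \<zero> \<zero>" ..
  show "i \<otimes>\<^bsub>Q\<^esub> i = \<ominus>\<^bsub>Q\<^esub> \<one>\<^bsub>Q\<^esub>" "j \<otimes>\<^bsub>Q\<^esub> j = \<ominus>\<^bsub>Q\<^esub> \<one>\<^bsub>Q\<^esub>" "k \<otimes>\<^bsub>Q\<^esub> k = \<ominus>\<^bsub>Q\<^esub> \<one>\<^bsub>Q\<^esub>"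
    "i \<otimes>\<^bsub>Q\<^esub> j \<otimes>\<^bsub>Q\<^esub> k = \<ominus>\<^bsub>Q\<^esub> \<one>\<^bsub>Q\<^esub>"
    unfolding m by (auto simp: Q_def quaternion_ring_def i_def j_def k_def R.minus_eq)
qed

end

theory Submission
  imports Defs
begin

text \<open>
  The norm \<open>N(x) = a\<^sup>2 + b\<^sup>2 + c\<^sup>2 + d\<^sup>2\<close> of \<open>x = a + b i + c j + d k\<close> decides whether \<open>x\<close> is a zero
  divisor modulo \<open>n\<close>. Writing \<open>x'\<close> for the conjugate of \<open>x\<close>, so that \<open>x' x = x x' = N(x)\<close>: if
  \<open>N(x)\<close> is prime to \<open>n\<close>, multiplication by \<open>x'\<close> turns \<open>x y = 0\<close> into \<open>N(x) y = 0\<close>, hence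
  \<open>y = 0\<close>. If a prime \<open>q\<close> divides both \<open>N(x)\<close> and \<open>n\<close>, then \<open>(n / q) x'\<close> annihilates \<open>x\<close>, and so
  does \<open>n / q\<close> in the one case where \<open>(n / q) x'\<close> vanishes, namely when \<open>q\<close> divides \<open>x\<close>
  (lemma \<open>zero_divisors_lipschitz_mod\<close>). As \<open>0\<close> is a zero divisor but not a vertex, the number of
  vertices is \<open>n\<^sup>4 - U(n) - 1\<close>, where \<open>U(n)\<close> counts the quaternions modulo \<open>n\<close> whose norm is prime
  to \<open>n\<close>. Both graphs have this same vertex set by definition.

  The function \<open>U\<close> is multiplicative by the Chinese remainder theorem (\<open>card_unit_quats_mult\<close>),
  and \<open>U(q\<^bsup>a\<^esup>) = q\<^bsup>4(a-1)\<^esup> U(q)\<close>, because being prime to \<open>q\<^bsup>a\<^esup>\<close> depends only on the residues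
  modulo \<open>q\<close> (\<open>card_unit_quats_power_Suc\<close>). It remains to know \<open>U\<close> at primes. Modulo 2 the norm is
  the sum of the components, which is odd for half of the 16 quaternions, so \<open>U(2) = 8\<close>. For an odd
  prime \<open>p\<close> a solution of \<open>s\<^sup>2 + t\<^sup>2 = -1\<close> modulo \<open>p\<close> gives a linear change of variables that
  turns the norm into the form \<open>x y + z w\<close>; up to the sign of one variable this is the determinant of a
  2 by 2 matrix, so \<open>U(p)\<close> is the order \<open>(p\<^sup>2 - 1)(p\<^sup>2 - p)\<close> of the general linear group
  (\<open>card_unit_quats_odd_prime\<close>).
\<close>

section \<open>Quaternions with components in a set\<close>

definition quats :: "'a set \<Rightarrow> 'a quaternion set" where
  "quats A = {x. set_quaternion x \<subseteq> A}"

lemma Quat_in_quats [simp]: "Quat a b c d \<in> quats A \<longleftrightarrow> a \<in> A \<and> b \<in> A \<and> c \<in> A \<and> d \<in> A"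
  by (simp add: quats_def)

lemma quats_eq_image: "quats A = (\<lambda>(a, b, c, d). Quat a b c d) ` (A \<times> A \<times> A \<times> A)"
proof (rule Set.set_eqI)
  fix x show "x \<in> quats A \<longleftrightarrow> x \<in> (\<lambda>(a, b, c, d). Quat a b c d) ` (A \<times> A \<times> A \<times> A)"
    by (cases x) (auto simp: image_iff)
qed

lemma finite_quats [simp]: "finite A \<Longrightarrow> finite (quats A)"
  by (simp add: quats_eq_image)

lemma card_quats: "card (quats A) = card A ^ 4"
proof -
  have "inj_on (\<lambda>(a, b, c, d). Quat a b c d) (A \<times> A \<times> A \<times> A)"
    by (auto simp: inj_on_def)
  then show ?thesis
    by (simp add: quats_eq_image card_image card_cartesian_product power4_eq_xxxx mult.assoc)
qed

text \<open>
  A decomposition of scalars into pairs, applied to each component, decomposes quaternions. With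
  residues and quotients this lifts from one modulus to a multiple of it; with residues for two
  coprime moduli it is the Chinese remainder theorem.
\<close>

lemma bij_betw_quats_Times:
  assumes "bij_betw (\<lambda>a. (f a, g a)) A (B \<times> C)"
  shows "bij_betw (\<lambda>x. (map_quaternion f x, map_quaternion g x)) (quats A) (quats B \<times> quats C)"
proof -
  have inj: "a = b" if "f a = f b" "g a = g b" "a \<in> A" "b \<in> A" for a b
    using assms that by (auto simp: bij_betw_def inj_on_def)
  have sub: "f a \<in> B \<and> g a \<in> C" if "a \<in> A" for a
    using bij_betwE[OF assms] that by auto
  have sur: "\<exists>a\<in>A. b = f a \<and> c = g a" if "b \<in> B" "c \<in> C" for b c
  proof -
    have "(b, c) \<in> (\<lambda>a. (f a, g a)) ` A"
      using that bij_betw_imp_surj_on[OF assms] by auto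
    then show ?thesis by auto
  qed
  show ?thesis
  proof (rule bij_betw_imageI)
    show "inj_on (\<lambda>x. (map_quaternion f x, map_quaternion g x)) (quats A)"
    proof (rule inj_onI)
      fix x y
      assume "x \<in> quats A" "y \<in> quats A"
        and "(map_quaternion f x, map_quaternion g x) = (map_quaternion f y, map_quaternion g y)"
      then show "x = y"
        by (cases x; cases y) (auto intro: inj)
    qed
    show "(\<lambda>x. (map_quaternion f x, map_quaternion g x)) ` quats A = quats B \<times> quats C"
    proof (intro equalityI subsetI)
      fix z assume "z \<in> (\<lambda>x. (map_quaternion f x, map_quaternion g x)) ` quats A"
      then obtain x where "x \<in> quats A" "z = (map_quaternion f x, map_quaternion g x)" by auto
      then show "z \<in> quats B \<times> quats C"
        by (cases x) (auto simp: sub)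
    next
      fix z assume "z \<in> quats B \<times> quats C"
      then obtain b1 b2 b3 b4 c1 c2 c3 c4
        where z: "z = (Quat b1 b2 b3 b4, Quat c1 c2 c3 c4)"
          and mem: "b1 \<in> B" "b2 \<in> B" "b3 \<in> B" "b4 \<in> B" "c1 \<in> C" "c2 \<in> C" "c3 \<in> C" "c4 \<in> C"
        by (metis Quat_in_quats mem_Sigma_iff quaternion.exhaust surj_pair)
      obtain a1 a2 a3 a4 where "a1 \<in> A" "b1 = f a1" "c1 = g a1" "a2 \<in> A" "b2 = f a2" "c2 = g a2"
        "a3 \<in> A" "b3 = f a3" "c3 = g a3" "a4 \<in> A" "b4 = f a4" "c4 = g a4"
        using sur[OF mem(1,5)] sur[OF mem(2,6)] sur[OF mem(3,7)] sur[OF mem(4,8)] by blast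
      then show "z \<in> (\<lambda>x. (map_quaternion f x, map_quaternion g x)) ` quats A"
        unfolding z by (intro image_eqI[of _ _ "Quat a1 a2 a3 a4"]) auto
    qed
  qed
qed

lemma bij_betw_if_inj_on_card_eq:
  assumes "inj_on f A" "f ` A \<subseteq> B" "finite B" "card A = card B"
  shows "bij_betw f A B"
  using assms by (simp add: bij_betw_def card_image card_subset_eq)

lemma card_Collect_bij_betw:
  assumes "bij_betw f A B" and "\<And>x. x \<in> A \<Longrightarrow> P x \<longleftrightarrow> Q (f x)"
  shows "card {x \<in> A. P x} = card {y \<in> B. Q y}"
proof -
  have "f ` {x \<in> A. P x} = {y \<in> B. Q y}"
    using assms by (auto simp: bij_betw_def)
  moreover have "inj_on f {x \<in> A. P x}"
    using assms(1) by (auto simp: bij_betw_def inj_on_def)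
  ultimately show ?thesis
    by (metis card_image)
qed

section \<open>Quaternions modulo \<open>m\<close> of invertible norm\<close>

definition qnorm :: "'a::comm_ring_1 quaternion \<Rightarrow> 'a" where
  "qnorm x = qre x ^ 2 + qi x ^ 2 + qj x ^ 2 + qk x ^ 2"

text \<open>
  These represent the units of the Lipschitz quaternions modulo \<open>m\<close>, a quaternion over a commutative
  ring being invertible exactly when its norm is.
\<close>

definition unit_quats :: "int \<Rightarrow> int quaternion set" where
  "unit_quats m = {x \<in> quats {0..<m}. coprime (qnorm x) m}"

lemma qnorm_cong_map_mod: "[qnorm (map_quaternion (\<lambda>a. a mod m) x) = qnorm x] (mod m)" for m :: int
  by (cases x) (simp add: qnorm_def cong_add cong_pow)

lemma coprime_qnorm_map_mod:
  "coprime (qnorm (map_quaternion (\<lambda>a. a mod m) x)) m \<longleftrightarrow> coprime (qnorm x) m" for m :: int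
  using cong_imp_coprime[OF qnorm_cong_map_mod] cong_imp_coprime[OF cong_sym[OF qnorm_cong_map_mod]]
  by blast

text \<open>
  The norm is a polynomial in the components, so it is compatible with reduction; hence the
  bijection given by the Chinese remainder theorem respects the norm condition.
\<close>

lemma card_unit_quats_mult:
  assumes "m > 0" "k > 0" "coprime m k"
  shows "card (unit_quats (m * k)) = card (unit_quats m) * card (unit_quats k)"
proof -
  have "bij_betw (\<lambda>a. (a mod m, a mod k)) {0..<m * k} ({0..<m} \<times> {0..<k})"
  proof (rule bij_betw_if_inj_on_card_eq)
    show "inj_on (\<lambda>a. (a mod m, a mod k)) {0..<m * k}"
    proof (rule inj_onI)
      fix a b assume ab: "a \<in> {0..<m * k}" "b \<in> {0..<m * k}" "(a mod m, a mod k) = (b mod m, b mod k)"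
      then have "[a = b] (mod m)" "[a = b] (mod k)"
        by (simp_all add: cong_def)
      then have "[a = b] (mod (m * k))"
        using assms(3) by (rule coprime_cong_mult)
      with ab show "a = b"
        by (simp add: cong_def)
    qed
  qed (use assms in \<open>auto simp: nat_mult_distrib\<close>)
  then have "card (unit_quats (m * k)) =
      card {y \<in> quats {0..<m} \<times> quats {0..<k}. coprime (qnorm (fst y)) m \<and> coprime (qnorm (snd y)) k}"
    unfolding unit_quats_def
    by (intro card_Collect_bij_betw[OF bij_betw_quats_Times]) (auto simp: coprime_qnorm_map_mod)
  also have "{y \<in> quats {0..<m} \<times> quats {0..<k}. coprime (qnorm (fst y)) m \<and> coprime (qnorm (snd y)) k}
      = unit_quats m \<times> unit_quats k"
    by (auto simp: unit_quats_def)
  finally show ?thesis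
    by (simp add: card_cartesian_product)
qed

text \<open>
  A number is prime to a power of \<open>m\<close> as soon as it is prime to \<open>m\<close>. Hence the condition
  constrains only the residues of the components modulo \<open>m\<close>, and the four quotients are free.
\<close>

lemma card_unit_quats_power_Suc:
  assumes "m > 0"
  shows "card (unit_quats (m ^ Suc j)) = card (unit_quats m) * nat m ^ (4 * j)"
proof -
  have "bij_betw (\<lambda>a. (a mod m, a div m)) {0..<m * m ^ j} ({0..<m} \<times> {0..<m ^ j})"
  proof (rule bij_betw_if_inj_on_card_eq)
    show "inj_on (\<lambda>a. (a mod m, a div m)) {0..<m * m ^ j}"
      by (rule inj_onI) (metis div_mult_mod_eq prod.inject)
    have "a div m < m ^ j" if "a < m * m ^ j" for a
    proof -
      have "m * (a div m) < m * m ^ j"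
        using that pos_mod_sign[OF assms, of a] by (simp add: minus_mod_eq_mult_div[symmetric])
      then show ?thesis
        using assms by simp
    qed
    then show "(\<lambda>a. (a mod m, a div m)) ` {0..<m * m ^ j} \<subseteq> {0..<m} \<times> {0..<m ^ j}"
      using assms by (auto simp: pos_imp_zdiv_nonneg_iff)
  qed (use assms in \<open>auto simp: nat_mult_distrib\<close>)
  then have "card (unit_quats (m * m ^ j)) =
      card {y \<in> quats {0..<m} \<times> quats {0..<m ^ j}. coprime (qnorm (fst y)) m}"
    unfolding unit_quats_def
    by (intro card_Collect_bij_betw[OF bij_betw_quats_Times]) (auto simp: coprime_qnorm_map_mod)
  also have "{y \<in> quats {0..<m} \<times> quats {0..<m ^ j}. coprime (qnorm (fst y)) m}
      = unit_quats m \<times> quats {0..<m ^ j}"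
    by (auto simp: unit_quats_def)
  finally show ?thesis
    using assms by (simp add: card_cartesian_product card_quats nat_power_eq power_mult[symmetric] mult.commute)
qed

lemma card_unit_quats_1: "card (unit_quats 1) = 1"
proof -
  have "unit_quats 1 = quats {0}"
    by (simp add: unit_quats_def) (metis atLeastLessThan_singleton add_0 atLeastLessThanPlusOne_atLeastAtMost_int atLeastAtMost_singleton)
  then show ?thesis
    by (simp add: card_quats)
qed

lemma card_unit_quats_prod:
  assumes "finite I" and "\<And>i. i \<in> I \<Longrightarrow> f i > 0"
    and "\<And>i j. i \<in> I \<Longrightarrow> j \<in> I \<Longrightarrow> i \<noteq> j \<Longrightarrow> coprime (f i) (f j)"
  shows "card (unit_quats (\<Prod>i\<in>I. f i)) = (\<Prod>i\<in>I. card (unit_quats (f i)))"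
  using assms
proof (induction I rule: finite_induct)
  case empty
  then show ?case by (simp add: card_unit_quats_1)
next
  case (insert i I)
  have "card (unit_quats (f i * prod f I)) = card (unit_quats (f i)) * card (unit_quats (prod f I))"
    using insert by (intro card_unit_quats_mult prod_pos prod_coprime_right) auto
  with insert show ?case by simp
qed

section \<open>Counting modulo a prime\<close>

lemma card_unit_quats_2: "card (unit_quats 2) = 8"
proof -
  have 2: "{0..<2} = {0, 1::int}" by auto
  have "unit_quats 2 = {Quat 1 0 0 0, Quat 0 1 0 0, Quat 0 0 1 0, Quat 0 0 0 1,
      Quat 0 1 1 1, Quat 1 0 1 1, Quat 1 1 0 1, Quat 1 1 1 0}" (is "_ = ?S")
  proof (rule Set.set_eqI)
    fix x show "x \<in> unit_quats 2 \<longleftrightarrow> x \<in> ?S"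
      by (cases x) (auto simp: unit_quats_def 2 qnorm_def)
  qed
  then show ?thesis by simp
qed

text \<open>
  Pigeonhole: the residues of \<open>x\<^sup>2\<close> and those of \<open>-1 - y\<^sup>2\<close>, for \<open>x\<close> and \<open>y\<close> between \<open>0\<close> and
  \<open>(p - 1) / 2\<close>, form two sets of \<open>(p + 1) / 2\<close> elements each, so they meet.
\<close>

lemma exists_sum_two_squares_cong_minus_one:
  fixes p :: int
  assumes "prime p" "odd p"
  obtains s t where "p dvd s ^ 2 + t ^ 2 + 1"
proof -
  define h where "h = (p - 1) div 2"
  have p: "p = 2 * h + 1" "p > 0"
    using assms prime_gt_0_int by (auto simp: h_def elim!: oddE)
  have inj: "x = y" if "p dvd x ^ 2 - y ^ 2" "x \<in> {0..h}" "y \<in> {0..h}" for x y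
  proof -
    have "p dvd (x - y) * (x + y)"
      using that(1) by (simp add: power2_eq_square algebra_simps)
    from prime_dvd_multD[OF assms(1) this] consider "p dvd x - y" | "p dvd x + y"
      by blast
    then show ?thesis
    proof cases
      case 1
      moreover have "\<bar>x - y\<bar> < \<bar>p\<bar>"
        using that p by auto
      ultimately have "x - y = 0"
        by (meson dvd_imp_le_int not_le)
      then show ?thesis using that by auto
    next
      case 2
      moreover have "\<bar>x + y\<bar> < \<bar>p\<bar>"
        using that p by auto
      ultimately have "x + y = 0"
        by (meson dvd_imp_le_int not_le)
      then show ?thesis using that by auto
    qed
  qed
  define A where "A = (\<lambda>x. x ^ 2 mod p) ` {0..h}"
  define B where "B = (\<lambda>x. (- 1 - x ^ 2) mod p) ` {0..h}"
  have "inj_on (\<lambda>x. x ^ 2 mod p) {0..h}"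
    by (rule inj_onI) (auto intro: inj simp: mod_eq_dvd_iff)
  then have "card A = nat (h + 1)"
    by (simp add: A_def card_image)
  moreover have "inj_on (\<lambda>x. (- 1 - x ^ 2) mod p) {0..h}"
  proof (rule inj_onI)
    fix x y assume xy: "x \<in> {0..h}" "y \<in> {0..h}" "(- 1 - x ^ 2) mod p = (- 1 - y ^ 2) mod p"
    then have "p dvd y ^ 2 - x ^ 2"
      by (simp add: mod_eq_dvd_iff)
    with xy show "x = y"
      using inj[of y x] by simp
  qed
  then have "card B = nat (h + 1)"
    by (simp add: B_def card_image)
  moreover have "A \<union> B \<subseteq> {0..<p}"
    using p(2) by (auto simp: A_def B_def)
  then have "card (A \<union> B) \<le> card {0..<p}"
    by (intro card_mono) auto
  then have "card (A \<union> B) \<le> nat p"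
    by simp
  moreover have "nat p < nat (h + 1) + nat (h + 1)"
    using p by linarith
  moreover have "finite A" "finite B"
    by (simp_all add: A_def B_def)
  ultimately have "A \<inter> B \<noteq> {}"
    using card_Un_disjoint[of A B] by linarith
  then obtain s t where "s ^ 2 mod p = (- 1 - t ^ 2) mod p"
    by (auto simp: A_def B_def)
  then have "p dvd s ^ 2 + t ^ 2 + 1"
    by (simp add: mod_eq_dvd_iff algebra_simps)
  then show ?thesis by (rule that)
qed

lemma card_affine_nonzero_mod_prime:
  fixes p a e :: int
  assumes "prime p" "\<not> p dvd a"
  shows "int (card {b \<in> {0..<p}. \<not> p dvd a * b + e}) = p - 1"
proof -
  have p: "p > 0" using assms prime_gt_0_int by auto
  have "bij_betw (\<lambda>b. (a * b + e) mod p) {0..<p} {0..<p}"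
  proof (rule bij_betw_if_inj_on_card_eq)
    show "inj_on (\<lambda>b. (a * b + e) mod p) {0..<p}"
    proof (rule inj_onI)
      fix b c assume bc: "b \<in> {0..<p}" "c \<in> {0..<p}" "(a * b + e) mod p = (a * c + e) mod p"
      then have "p dvd a * (b - c)"
        by (simp add: mod_eq_dvd_iff algebra_simps)
      then have "p dvd b - c"
        using assms by (simp add: prime_dvd_mult_iff)
      then have "b mod p = c mod p"
        by (simp add: mod_eq_dvd_iff)
      with bc show "b = c" by simp
    qed
  qed (use p in auto)
  then have "card {b \<in> {0..<p}. \<not> p dvd a * b + e} = card {y \<in> {0..<p}. y \<noteq> 0}"
    by (rule card_Collect_bij_betw) (simp add: dvd_eq_mod_eq_0)
  also have "{y \<in> {0..<p}. y \<noteq> 0} = {1..<p}" by auto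
  finally show ?thesis using p by simp
qed

text \<open>
  The components are fixed in the order \<open>a\<close>, \<open>c\<close>, \<open>d\<close>, and the admissible \<open>b\<close> with
  \<open>a b + c d \<noteq> 0\<close> are counted: there are \<open>p - 1\<close> of them if \<open>a \<noteq> 0\<close>; for \<open>a = 0\<close> the choice of \<open>b\<close>
  is immaterial, so that there are \<open>p\<close> or none according to whether \<open>c d\<close> is nonzero.
\<close>

lemma card_hyperbolic_nonzero_mod_prime:
  fixes p :: int
  assumes "prime p"
  shows "int (card {x \<in> quats {0..<p}. \<not> p dvd qre x * qi x + qj x * qk x}) = p * (p - 1) ^ 2 * (p + 1)"
proof -
  define B where "B = {0..<p}"
  have p: "p > 1" using assms prime_gt_1_int by auto
  have fin: "finite B" and cB: "int (card B) = p" and cB1: "int (card (B - {0})) = p - 1"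
    using p by (auto simp: B_def)
  have dvd0: "p dvd a \<longleftrightarrow> a = 0" if "a \<in> B" for a
    using that zdvd_not_zless[of a p] by (auto simp: B_def dest: order_le_imp_less_or_eq)
  define F where "F = (\<lambda>(a, c, d). {b \<in> B. \<not> p dvd a * b + c * d})"
  have "{x \<in> quats B. \<not> p dvd qre x * qi x + qj x * qk x} =
      (\<lambda>((a, c, d), b). Quat a b c d) ` Sigma (B \<times> B \<times> B) F" (is "?L = ?R")
  proof (rule Set.set_eqI)
    fix x show "x \<in> ?L \<longleftrightarrow> x \<in> ?R"
      by (cases x) (auto simp: F_def image_iff)
  qed
  moreover have "inj_on (\<lambda>((a, c, d), b). Quat a b c d) (Sigma (B \<times> B \<times> B) F)"
    by (auto simp: inj_on_def)
  ultimately have "card ?L = card (Sigma (B \<times> B \<times> B) F)"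
    by (simp add: card_image)
  also have "\<dots> = (\<Sum>z\<in>B \<times> B \<times> B. card (F z))"
    using fin by (intro card_SigmaI) (auto simp: F_def)
  also have "\<dots> = (\<Sum>a\<in>B. \<Sum>c\<in>B. \<Sum>d\<in>B. card (F (a, c, d)))"
    by (simp add: sum.cartesian_product split_def)
  finally have "int (card ?L) = (\<Sum>a\<in>B. \<Sum>c\<in>B. \<Sum>d\<in>B. int (card (F (a, c, d))))"
    by simp
  also have "\<dots> = (\<Sum>a\<in>B. if a = 0 then p * (p - 1) ^ 2 else p ^ 2 * (p - 1))"
  proof (rule sum.cong)
    fix a assume a: "a \<in> B"
    show "(\<Sum>c\<in>B. \<Sum>d\<in>B. int (card (F (a, c, d)))) =
        (if a = 0 then p * (p - 1) ^ 2 else p ^ 2 * (p - 1))"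
    proof (cases "a = 0")
      case True
      have "int (card (F (a, c, d))) = (if c = 0 then 0 else if d = 0 then 0 else p)"
        if "c \<in> B" "d \<in> B" for c d
        using that True assms cB by (simp add: F_def prime_dvd_mult_iff dvd0)
      then have "(\<Sum>c\<in>B. \<Sum>d\<in>B. int (card (F (a, c, d)))) =
          (\<Sum>c\<in>B. \<Sum>d\<in>B. if c = 0 then 0 else if d = 0 then 0 else p)"
        by simp
      also have "\<dots> = (\<Sum>c\<in>B - {0}. \<Sum>d\<in>B - {0}. p)"
        using fin by (intro sum.mono_neutral_cong_right) (auto intro!: sum.mono_neutral_cong_right)
      finally show ?thesis
        using True cB1 by (simp add: power2_eq_square)
    next
      case False
      then have "int (card (F (a, c, d))) = p - 1" for c d
        using a card_affine_nonzero_mod_prime[OF assms, of a "c * d"] dvd0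
        by (simp add: F_def B_def)
      then show ?thesis
        using False cB by (simp add: power2_eq_square)
    qed
  qed simp
  also have "\<dots> = p * (p - 1) ^ 2 + (\<Sum>a\<in>B - {0}. p ^ 2 * (p - 1))"
    using fin p by (subst sum.remove[of _ 0]) (auto simp: B_def intro!: sum.cong)
  also have "\<dots> = p * (p - 1) ^ 2 * (p + 1)"
    unfolding sum_constant of_nat_id cB1 by (simp add: power2_eq_square algebra_simps)
  finally show ?thesis
    by (simp add: B_def)
qed

text \<open>
  Let \<open>s\<^sup>2 + t\<^sup>2 = -1\<close>. The substitution \<open>u = s b + t d\<close>, \<open>v = t b - s d\<close> gives
  \<open>b\<^sup>2 + d\<^sup>2 = - (u\<^sup>2 + v\<^sup>2)\<close>, so the norm becomes
  \<open>a\<^sup>2 - u\<^sup>2 + c\<^sup>2 - v\<^sup>2 = (a - u)(a + u) + (c - v)(c + v)\<close>. The resulting map \<open>\<psi>\<close> on quaternions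
  modulo \<open>p\<close> is injective, as \<open>2\<close> and \<open>s\<^sup>2 + t\<^sup>2\<close> are invertible, hence bijective.
\<close>

lemma card_unit_quats_odd_prime:
  fixes p :: int
  assumes "prime p" "odd p"
  shows "int (card (unit_quats p)) = p * (p - 1) ^ 2 * (p + 1)"
proof -
  obtain s t where st: "p dvd s ^ 2 + t ^ 2 + 1"
    using exists_sum_two_squares_cong_minus_one[OF assms] .
  have p: "p > 0" using assms prime_gt_0_int by auto
  have cop2: "coprime p 2" using assms(2) by simp
  define u where "u = (\<lambda>b d. s * b + t * d)"
  define v where "v = (\<lambda>b d. t * b - s * d)"
  define \<psi> where "\<psi> = (\<lambda>x. map_quaternion (\<lambda>a. a mod p)
    (Quat (qre x - u (qi x) (qk x)) (qre x + u (qi x) (qk x))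
          (qj x - v (qi x) (qk x)) (qj x + v (qi x) (qk x))))"
  have canc2: "p dvd a" if "p dvd 2 * a" for a
    using that cop2 by (simp add: coprime_dvd_mult_right_iff)
  have halves: "p dvd a \<and> p dvd b" if "p dvd a - b" "p dvd a + b" for a b
    using canc2[of a] canc2[of b] dvd_add[OF that] dvd_diff[OF that(2,1)] by (simp add: algebra_simps)
  have uv: "p dvd b \<and> p dvd d" if "p dvd u b d" "p dvd v b d" for b d
  proof -
    \<comment> \<open>The substitution is its own inverse up to the factor \<open>s\<^sup>2 + t\<^sup>2\<close>, which is \<open>-1\<close> modulo \<open>p\<close>.\<close>
    have "p dvd (s ^ 2 + t ^ 2 + 1) * b - (s * u b d + t * v b d)"
      "p dvd (s ^ 2 + t ^ 2 + 1) * d - (t * u b d - s * v b d)"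
      using st that by (auto intro!: dvd_diff dvd_add)
    moreover have "(s ^ 2 + t ^ 2 + 1) * b - (s * u b d + t * v b d) = b"
      "(s ^ 2 + t ^ 2 + 1) * d - (t * u b d - s * v b d) = d"
      by (simp_all add: u_def v_def power2_eq_square algebra_simps)
    ultimately show ?thesis
      by simp
  qed
  have "bij_betw \<psi> (quats {0..<p}) (quats {0..<p})"
  proof (rule bij_betw_if_inj_on_card_eq)
    show "inj_on \<psi> (quats {0..<p})"
    proof (rule inj_onI)
      fix x y assume xy: "x \<in> quats {0..<p}" "y \<in> quats {0..<p}" "\<psi> x = \<psi> y"
      obtain a b c d a' b' c' d' where x: "x = Quat a b c d" and y: "y = Quat a' b' c' d'"
        by (metis quaternion.exhaust)
      have uvd: "u b d - u b' d' = u (b - b') (d - d')" "v b d - v b' d' = v (b - b') (d - d')"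
        by (simp_all add: u_def v_def algebra_simps)
      have "p dvd (a - u b d) - (a' - u b' d')" "p dvd (a + u b d) - (a' + u b' d')"
        "p dvd (c - v b d) - (c' - v b' d')" "p dvd (c + v b d) - (c' + v b' d')"
        using xy(3) by (simp_all add: x y \<psi>_def mod_eq_dvd_iff)
      then have "p dvd (a - a') - u (b - b') (d - d')" "p dvd (a - a') + u (b - b') (d - d')"
        "p dvd (c - c') - v (b - b') (d - d')" "p dvd (c - c') + v (b - b') (d - d')"
        by (simp_all flip: uvd add: algebra_simps)
      then have ac: "p dvd a - a'" "p dvd c - c'"
        and "p dvd u (b - b') (d - d')" "p dvd v (b - b') (d - d')"
        using halves by blast+
      then have "p dvd b - b'" "p dvd d - d'"
        using uv by blast+
      with ac have "a mod p = a' mod p" "b mod p = b' mod p" "c mod p = c' mod p" "d mod p = d' mod p"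
        by (simp_all add: mod_eq_dvd_iff)
      then show "x = y"
        using xy(1,2) by (simp add: x y)
    qed
  qed (use p in \<open>auto simp: \<psi>_def\<close>)
  then have "card (unit_quats p) =
      card {x \<in> quats {0..<p}. \<not> p dvd qre x * qi x + qj x * qk x}"
    unfolding unit_quats_def
  proof (rule card_Collect_bij_betw)
    fix x :: "int quaternion"
    obtain a b c d where x: "x = Quat a b c d"
      by (cases x)
    have "[qre (\<psi> x) * qi (\<psi> x) + qj (\<psi> x) * qk (\<psi> x) =
        (a - u b d) * (a + u b d) + (c - v b d) * (c + v b d)] (mod p)"
      by (simp add: \<psi>_def x cong_add cong_mult)
    also have "(a - u b d) * (a + u b d) + (c - v b d) * (c + v b d)
        = qnorm x - (s ^ 2 + t ^ 2 + 1) * (b ^ 2 + d ^ 2)"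
      by (simp add: x qnorm_def u_def v_def power2_eq_square algebra_simps)
    also have "[\<dots> = qnorm x] (mod p)"
      using st by (simp add: cong_iff_dvd_diff)
    finally have "p dvd qre (\<psi> x) * qi (\<psi> x) + qj (\<psi> x) * qk (\<psi> x) \<longleftrightarrow> p dvd qnorm x"
      by (rule cong_dvd_iff)
    moreover have "coprime (qnorm x) p \<longleftrightarrow> \<not> p dvd qnorm x"
      using assms(1) prime_imp_coprime[OF assms(1), of "qnorm x"] not_prime_unit[of p]
      by (cases "p dvd qnorm x") (auto simp: coprime_absorb_right coprime_commute)
    ultimately show "coprime (qnorm x) p \<longleftrightarrow>
        \<not> p dvd qre (\<psi> x) * qi (\<psi> x) + qj (\<psi> x) * qk (\<psi> x)"
      by simp
  qed
  then show ?thesis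
    using card_hyperbolic_nonzero_mod_prime[OF assms(1)] by simp
qed

lemma card_unit_quats_odd_prime_power:
  fixes p :: int
  assumes "prime p" "odd p" "a \<ge> 1"
  shows "int (card (unit_quats (p ^ a))) = p ^ (4 * a) - p ^ (4 * a - 1) - p ^ (4 * a - 2) + p ^ (4 * a - 3)"
proof -
  obtain j where a: "a = Suc j"
    using assms(3) by (cases a) auto
  have p: "p > 0" using assms prime_gt_0_int by auto
  define P where "P = p ^ (4 * j)"
  have e: "p ^ (4 * a) = p ^ 4 * P" "p ^ (4 * a - 1) = p ^ 3 * P" "p ^ (4 * a - 2) = p ^ 2 * P"
    "p ^ (4 * a - 3) = p * P"
    by (simp_all add: a P_def eval_nat_numeral)
  have "int (card (unit_quats (p ^ a))) = p * (p - 1) ^ 2 * (p + 1) * P"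
    unfolding a card_unit_quats_power_Suc[OF p] using p
    by (simp add: card_unit_quats_odd_prime[OF assms(1,2)] P_def)
  also have "\<dots> = p ^ (4 * a) - p ^ (4 * a - 1) - p ^ (4 * a - 2) + p ^ (4 * a - 3)"
    unfolding e by (simp add: eval_nat_numeral algebra_simps)
  finally show ?thesis .
qed

lemma card_unit_quats_two_power:
  assumes "t > 0"
  shows "card (unit_quats (2 ^ t)) = 2 ^ (4 * t - 1)"
proof -
  obtain j where t: "t = Suc j"
    using assms by (cases t) auto
  have "4 * t - 1 = 3 + 4 * j" by (simp add: t)
  then show ?thesis
    unfolding t card_unit_quats_power_Suc[OF zero_less_numeral] card_unit_quats_2
    by (simp add: power_add)
qed

section \<open>Zero divisors\<close>

fun hamilton :: "'a::comm_ring_1 quaternion \<Rightarrow> 'a quaternion \<Rightarrow> 'a quaternion" where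
  "hamilton (Quat a b c d) (Quat a' b' c' d') = Quat
     (a * a' - b * b' - c * c' - d * d') (a * b' + b * a' + c * d' - d * c')
     (a * c' - b * d' + c * a' + d * b') (a * d' + b * c' - c * b' + d * a')"

lemma
  assumes "n > 1"
  shows carrier_lipschitz_mod: "carrier (lipschitz_mod n) = quats {0..<int n}"
    and mult_lipschitz_mod:
      "x \<otimes>\<^bsub>lipschitz_mod n\<^esub> y = map_quaternion (\<lambda>a. a mod int n) (hamilton x y)"
    and zero_lipschitz_mod: "\<zero>\<^bsub>lipschitz_mod n\<^esub> = Quat 0 0 0 0"
proof -
  interpret R: residues "int n" "residue_ring (int n)"
    using assms by unfold_locales auto
  show "carrier (lipschitz_mod n) = quats {0..<int n}"
  proof (rule Set.set_eqI)
    fix x show "x \<in> carrier (lipschitz_mod n) \<longleftrightarrow> x \<in> quats {0..<int n}"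
      by (cases x) (auto simp: lipschitz_mod_def quaternion_ring_def R.res_carrier_eq)
  qed
  show "x \<otimes>\<^bsub>lipschitz_mod n\<^esub> y = map_quaternion (\<lambda>a. a mod int n) (hamilton x y)"
    by (cases x; cases y)
      (simp add: lipschitz_mod_def quaternion_ring_def a_minus_def R.res_add_eq R.res_mult_eq
        R.res_neg_eq mod_simps)
  show "\<zero>\<^bsub>lipschitz_mod n\<^esub> = Quat 0 0 0 0"
    by (simp add: lipschitz_mod_def quaternion_ring_def R.res_zero_eq)
qed

definition qconj :: "'a::comm_ring_1 quaternion \<Rightarrow> 'a quaternion" where
  "qconj x = Quat (qre x) (- qi x) (- qj x) (- qk x)"

definition qscale :: "'a::comm_ring_1 \<Rightarrow> 'a quaternion \<Rightarrow> 'a quaternion" where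
  "qscale c = map_quaternion ((*) c)"

text \<open>
  Associativity together with \<open>x' x = x x' = N(x)\<close> for the conjugate \<open>x'\<close>.
\<close>

lemma hamilton_qconj_cancel:
  "hamilton (qconj x) (hamilton x y) = qscale (qnorm x) y"
  "hamilton (hamilton y x) (qconj x) = qscale (qnorm x) y"
  by (cases x; cases y; simp add: qconj_def qnorm_def qscale_def power2_eq_square algebra_simps)+

lemma hamilton_qscale_qconj: "hamilton x (qscale c (qconj x)) = qscale c (Quat (qnorm x) 0 0 0)"
  by (cases x) (simp add: qconj_def qnorm_def qscale_def power2_eq_square algebra_simps)

lemma hamilton_scalar: "hamilton x (qscale c (Quat 1 0 0 0)) = qscale c x"
  by (cases x) (simp add: qscale_def algebra_simps)

text \<open>
  Products modulo \<open>m\<close> are integral products reduced componentwise, so an equation \<open>x y = 0\<close>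
  modulo \<open>m\<close> is the statement that \<open>m\<close> divides every component of the integral product.
\<close>

definition qdvd :: "int \<Rightarrow> int quaternion \<Rightarrow> bool" where
  "qdvd m x \<longleftrightarrow> (\<forall>c\<in>set_quaternion x. m dvd c)"

lemma qdvd_Quat [simp]: "qdvd m (Quat a b c d) \<longleftrightarrow> m dvd a \<and> m dvd b \<and> m dvd c \<and> m dvd d"
  by (simp add: qdvd_def)

lemma map_mod_eq_0_iff: "map_quaternion (\<lambda>a. a mod m) x = Quat 0 0 0 0 \<longleftrightarrow> qdvd m x"
  by (cases x) (simp add: dvd_eq_mod_eq_0)

lemma qdvd_hamilton: "qdvd m x \<Longrightarrow> qdvd m (hamilton x y)" "qdvd m y \<Longrightarrow> qdvd m (hamilton x y)"
  by (cases x; cases y; auto intro!: dvd_add dvd_diff)+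

lemma qdvd_hamilton_mod:
  "qdvd m (hamilton x (map_quaternion (\<lambda>a. a mod m) y)) \<longleftrightarrow> qdvd m (hamilton x y)"
proof -
  have "map_quaternion (\<lambda>a. a mod m) (hamilton x (map_quaternion (\<lambda>a. a mod m) y)) =
      map_quaternion (\<lambda>a. a mod m) (hamilton x y)"
    by (cases x; cases y) (simp, intro conjI cong_def[THEN iffD1] cong_add cong_diff cong_mult; simp)
  then show ?thesis
    by (metis map_mod_eq_0_iff)
qed

lemma qdvd_qscale_coprime: "coprime c m \<Longrightarrow> qdvd m (qscale c x) \<longleftrightarrow> qdvd m x"
  by (cases x) (simp add: qscale_def coprime_dvd_mult_right_iff coprime_commute[of c m])

text \<open>
  In the direction that needs an annihilator \<open>y\<close> of \<open>x\<close>, one exists with \<open>x y = 0\<close>; conversely, the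
  conjugate excludes \<open>x y = 0\<close> and \<open>y x = 0\<close> alike. So left and right zero divisors coincide.
\<close>

lemma zero_divisors_lipschitz_mod:
  assumes "n > 1"
  shows "zero_divisors (lipschitz_mod n) = quats {0..<int n} - unit_quats (int n)"
proof (rule Set.set_eqI)
  let ?m = "int n"
  fix x
  have zd: "x \<in> zero_divisors (lipschitz_mod n) \<longleftrightarrow> x \<in> quats {0..<?m} \<and>
      (\<exists>y\<in>quats {0..<?m}. y \<noteq> Quat 0 0 0 0 \<and> (qdvd ?m (hamilton x y) \<or> qdvd ?m (hamilton y x)))"
    using assms by (simp add: zero_divisors_def carrier_lipschitz_mod mult_lipschitz_mod
        zero_lipschitz_mod map_mod_eq_0_iff)
  have reduced: "y = Quat 0 0 0 0" if "y \<in> quats {0..<?m}" "qdvd ?m y" for y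
  proof -
    have "map_quaternion (\<lambda>a. a mod ?m) y = y"
      using that(1) by (cases y) simp
    then show ?thesis
      using that(2) by (metis map_mod_eq_0_iff)
  qed
  have "qdvd ?m y" if "coprime (qnorm x) ?m" "qdvd ?m (hamilton x y) \<or> qdvd ?m (hamilton y x)" for y
    using that qdvd_hamilton hamilton_qconj_cancel qdvd_qscale_coprime by metis
  moreover have "\<exists>y\<in>quats {0..<?m}. y \<noteq> Quat 0 0 0 0 \<and> qdvd ?m (hamilton x y)"
    if ncop: "\<not> coprime (qnorm x) ?m"
  proof -
    have "gcd (qnorm x) ?m \<noteq> 0" "\<not> is_unit (gcd (qnorm x) ?m)"
      using ncop assms by (auto simp: coprime_iff_gcd_eq_1)
    then obtain q where "prime q" "q dvd gcd (qnorm x) ?m"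
      using prime_divisor_exists by blast
    then have q: "prime q" "q dvd qnorm x" "q dvd ?m"
      by auto
    then obtain r where r: "?m = q * r" by (elim dvdE)
    have qdvd_qscale: "qdvd ?m (qscale r y) \<longleftrightarrow> qdvd q y" if "r > 0" for y
      using that by (cases y) (simp add: r qscale_def)
    have q1: "q > 1"
      using q(1) by (rule prime_gt_1_int)
    have "q * r > 0"
      using assms r by simp
    then have r0: "r > 0"
      by (rule zero_less_mult_pos) (use q1 in simp)
    \<comment> \<open>The conjugate of \<open>x\<close> times \<open>n / q\<close> vanishes modulo \<open>n\<close> when \<open>q\<close> divides \<open>x\<close>; then \<open>n / q\<close>
      itself is an annihilator.\<close>
    define w where "w = (if qdvd q x then Quat 1 0 0 0 else qconj x)"
    have "\<not> qdvd q w"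
      using q1 by (cases x) (auto simp: w_def qconj_def)
    then have "\<not> qdvd ?m (qscale r w)"
      using r0 by (simp add: qdvd_qscale)
    moreover have "qdvd ?m (hamilton x (qscale r w))"
    proof (cases "qdvd q x")
      case True
      then show ?thesis
        using r0 by (simp add: w_def hamilton_scalar qdvd_qscale)
    next
      case False
      then show ?thesis
        using q(2) r0 by (simp add: w_def hamilton_qscale_qconj qdvd_qscale)
    qed
    moreover have "map_quaternion (\<lambda>a. a mod ?m) y \<in> quats {0..<?m}" for y
      using assms by (cases y) simp
    ultimately show ?thesis
      by (intro bexI[of _ "map_quaternion (\<lambda>a. a mod ?m) (qscale r w)"])
         (simp_all add: map_mod_eq_0_iff qdvd_hamilton_mod)
  qed
  ultimately show "x \<in> zero_divisors (lipschitz_mod n) \<longleftrightarrow> x \<in> quats {0..<?m} - unit_quats ?m"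
    unfolding zd unit_quats_def using reduced by blast
qed

lemma card_zero_divisor_digraph_lipschitz_mod:
  assumes "n > 1"
  shows "int (card (pverts (zero_divisor_digraph (lipschitz_mod n)))) =
    int n ^ 4 - int (card (unit_quats (int n))) - 1"
proof -
  let ?Q = "quats {0..<int n}"
  have sub: "insert (Quat 0 0 0 0) (unit_quats (int n)) \<subseteq> ?Q"
    using assms by (auto simp: unit_quats_def)
  have notin: "Quat 0 0 0 0 \<notin> unit_quats (int n)"
    using assms by (simp add: unit_quats_def qnorm_def)
  have fin: "finite ?Q" by simp
  have "pverts (zero_divisor_digraph (lipschitz_mod n)) = ?Q - insert (Quat 0 0 0 0) (unit_quats (int n))"
    using assms by (auto simp: zero_divisor_digraph_def zero_divisors_lipschitz_mod zero_lipschitz_mod)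
  then have "int (card (pverts (zero_divisor_digraph (lipschitz_mod n)))) =
      int (card ?Q) - int (card (insert (Quat 0 0 0 0) (unit_quats (int n))))"
    using sub fin by (simp only: card_Diff_subset finite_subset of_nat_diff card_mono)
  also have "card (insert (Quat 0 0 0 0) (unit_quats (int n))) = Suc (card (unit_quats (int n)))"
    using notin sub fin by (intro card_insert_disjoint) (auto intro: finite_subset)
  finally show ?thesis
    by (simp add: card_quats)
qed

theorem theorem1:
  fixes n t k :: nat and p \<alpha> :: "nat \<Rightarrow> nat"
  assumes "n > 1"
    and "n = 2 ^ t * (\<Prod>i=1..k. p i ^ \<alpha> i)"
    and "\<And>i. i \<in> {1..k} \<Longrightarrow> prime (p i) \<and> odd (p i)"
    and "inj_on p {1..k}"
    and "\<And>i. i \<in> {1..k} \<Longrightarrow> \<alpha> i \<ge> 1"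
  shows "int (card (pverts (zero_divisor_digraph (lipschitz_mod n)))) =
      (if t = 0
       then int n ^ 4
         - (\<Prod>i=1..k. int (p i) ^ (4 * \<alpha> i) - int (p i) ^ (4 * \<alpha> i - 1)
              - int (p i) ^ (4 * \<alpha> i - 2) + int (p i) ^ (4 * \<alpha> i - 3))
         - 1
       else int n ^ 4
         - 2 ^ (4 * t - 1)
           * (\<Prod>i=1..k. int (p i) ^ (4 * \<alpha> i) - int (p i) ^ (4 * \<alpha> i - 1)
                - int (p i) ^ (4 * \<alpha> i - 2) + int (p i) ^ (4 * \<alpha> i - 3))
         - 1)
    \<and> pverts (zero_divisor_graph (lipschitz_mod n)) =
      pverts (zero_divisor_digraph (lipschitz_mod n))"
proof -
  define P where "P = (\<Prod>i=1..k. int (p i) ^ \<alpha> i)"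
  define D where "D = (\<Prod>i=1..k. int (p i) ^ (4 * \<alpha> i) - int (p i) ^ (4 * \<alpha> i - 1)
              - int (p i) ^ (4 * \<alpha> i - 2) + int (p i) ^ (4 * \<alpha> i - 3))"
  have n: "int n = 2 ^ t * P"
    by (simp add: assms(2) P_def)
  have prime: "prime (int (p i))" "odd (int (p i))" if "i \<in> {1..k}" for i
    using assms(3)[OF that] by auto
  have pos: "int (p i) ^ \<alpha> i > 0" if "i \<in> {1..k}" for i
    by (intro zero_less_power prime_gt_0_int prime(1) that)
  have Ppos: "P > 0"
    unfolding P_def using pos by (rule prod_pos)
  have "int (card (unit_quats P)) = int (\<Prod>i=1..k. card (unit_quats (int (p i) ^ \<alpha> i)))"
    unfolding P_def of_nat_eq_iff
  proof (rule card_unit_quats_prod)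
    fix i j assume ij: "i \<in> {1..k}" "j \<in> {1..k}" "i \<noteq> j"
    then have "p i \<noteq> p j"
      using inj_onD[OF assms(4) _ ij(1,2)] by blast
    then have "coprime (int (p i)) (int (p j))"
      by (intro primes_coprime prime(1) ij(1,2)) simp
    then show "coprime (int (p i) ^ \<alpha> i) (int (p j) ^ \<alpha> j)"
      by simp
  qed (simp, rule pos)
  also have "\<dots> = D"
    unfolding D_def of_nat_prod
    by (intro prod.cong refl card_unit_quats_odd_prime_power prime assms(5))
  finally have P: "int (card (unit_quats P)) = D" .
  have units: "int (card (unit_quats (int n))) = (if t = 0 then D else 2 ^ (4 * t - 1) * D)"
  proof (cases "t = 0")
    case False
    have "coprime (2 ^ t) P"
      unfolding P_def using prime(2) by (intro prod_coprime_right) simp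
    then have "card (unit_quats (int n)) = card (unit_quats (2 ^ t)) * card (unit_quats P)"
      unfolding n using Ppos by (intro card_unit_quats_mult) auto
    with False P show ?thesis
      by (simp add: card_unit_quats_two_power)
  qed (simp add: n P)
  have "int (card (pverts (zero_divisor_digraph (lipschitz_mod n)))) =
      (if t = 0 then int n ^ 4 - D - 1 else int n ^ 4 - 2 ^ (4 * t - 1) * D - 1)"
    by (simp add: card_zero_divisor_digraph_lipschitz_mod[OF assms(1)] units)
  moreover have "pverts (zero_divisor_graph (lipschitz_mod n)) = pverts (zero_divisor_digraph (lipschitz_mod n))"
    by (simp add: zero_divisor_graph_def zero_divisor_digraph_def)
  ultimately show ?thesis
    unfolding D_def by (rule conjI)
qed

end
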